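(* Let $\mathcal{M}\subset\mathbb{R}^{n\times n}$ be compact, convex and irreducible with $\rho(\mathcal{M})=0$, let $v$ be a Barabanov norm and $S=\{x\in\mathbb{R}^n:v(x)=1\}$. Let $x_0\in S$. Assume that the set $\mathcal{V}_{x_0}$ is not empty and contains $n-1$ linearly independent elements, where $\mathcal{V}_{x_0}$ is the set of all $l\in\mathbb{R}^n$ for which there exist $t_0>0$, an extremal solution $x(\cdot)$ with $x(t_0)=x_0$, and a sequence $(t_j)_{j\ge1}$ with $t_j\to t_0^-$ such that $l=\lim_{j\to+\infty}\frac{x(t_j)-x_0}{t_j-t_0}$. Then $v(\cdot)$ is differentiable at $x_0$.
   Context: A switching law is a measurable $A:[0,\infty)\to\mathcal{M}$; a solution of the switched system is an absolutely continuous $x:[0,\infty)\to\mathbb{R}^n$ with $\dot x(t)=A(t)x(t)$ a.e. for some switching law. $\mathcal{M}$ is irreducible if no nonzero proper subspace of $\mathbb{R}^n$ is invariant under all $A\in\mathcal{M}$. $\rho(\mathcal{M}):=\sup\limsup_{t\to+\infty}\frac1t\log\|x(t)\|$, supremum over all solutions with $x(0)\ne0$. A Barabanov norm is a norm $v$ on $\mathbb{R}^n$ such that (1) $v(x(t))\le v(x(0))$ for every solution $x(\cdot)$ and $t\ge0$; (2) for every $y\in\mathbb{R}^n$ there is a solution $x(\cdot)$ with $x(0)=y$ and $v(x(t))=v(y)$ for all $t\ge0$. A solution is extremal if $v(x(t))=v(x(0))$ for all $t\ge0$. $t_j\to t_0^-$ means $t_j<t_0$ and $t_j\to t_0$. 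*)

theory Defs
  imports "HOL-Analysis.Analysis"
begin

text \<open>Matrices are elements of \<^typ>\<open>real^'n^'n\<close>. Trajectories and switching laws are total
  functions on the reals of which only the values at times \<open>t \<ge> 0\<close> are constrained or used.\<close>

definition absolutely_continuous_on_interval ::
    "real \<Rightarrow> real \<Rightarrow> (real \<Rightarrow> 'a::real_normed_vector) \<Rightarrow> bool" where
  "absolutely_continuous_on_interval s t f \<longleftrightarrow>
     (\<forall>\<epsilon>>0. \<exists>\<delta>>0. \<forall>(N::nat) a b.
        (\<forall>i<N. s \<le> a i \<and> a i \<le> b i \<and> b i \<le> t) \<longrightarrow>
        disjoint_family_on (\<lambda>i. {a i<..<b i}) {..<N} \<longrightarrow>
        (\<Sum>i<N. b i - a i) < \<delta> \<longrightarrow>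
        (\<Sum>i<N. norm (f (b i) - f (a i))) < \<epsilon>)"

definition switching_law :: "(real^'n^'n) set \<Rightarrow> (real \<Rightarrow> real^'n^'n) \<Rightarrow> bool" where
  "switching_law M A \<longleftrightarrow>
     A \<in> borel_measurable (lebesgue_on {0..}) \<and> (\<forall>t\<ge>0. A t \<in> M)"

text \<open>On the unbounded interval \<open>[0,\<infinity>)\<close>, absolute continuity is understood on each compact
  subinterval, as usual for solutions of differential equations: \<open>t \<mapsto> exp t\<close> is not absolutely
  continuous on all of \<open>[0,\<infinity>)\<close> with a single \<open>\<delta>\<close>.\<close>

definition switched_solution :: "(real^'n^'n) set \<Rightarrow> (real \<Rightarrow> real^'n) \<Rightarrow> bool" where
  "switched_solution M x \<longleftrightarrow>
     (\<forall>T\<ge>0. absolutely_continuous_on_interval 0 T x) \<and>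
     (\<exists>A. switching_law M A \<and>
        (AE t in lebesgue_on {0..}. (x has_vector_derivative (A t *v x t)) (at t within {0..})))"

definition irreducible_matrices :: "(real^'n^'n) set \<Rightarrow> bool" where
  "irreducible_matrices M \<longleftrightarrow>
     \<not> (\<exists>W. subspace W \<and> W \<noteq> {0} \<and> W \<noteq> UNIV \<and> (\<forall>A\<in>M. \<forall>w\<in>W. A *v w \<in> W))"

text \<open>A solution with \<open>x 0 \<noteq> 0\<close> over a bounded set of matrices never vanishes, so the convention
  \<open>ln 0 = 0\<close> does not interfere.\<close>

definition max_lyapunov_exponent :: "(real^'n^'n) set \<Rightarrow> ereal" where
  "max_lyapunov_exponent M =
     (SUP x\<in>{x. switched_solution M x \<and> x 0 \<noteq> 0}.
        Limsup at_top (\<lambda>t. ereal (1 / t * ln (norm (x t)))))"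

definition is_norm :: "('a::real_vector \<Rightarrow> real) \<Rightarrow> bool" where
  "is_norm v \<longleftrightarrow>
     (\<forall>x. 0 \<le> v x) \<and> (\<forall>x. v x = 0 \<longleftrightarrow> x = 0) \<and>
     (\<forall>c x. v (c *\<^sub>R x) = \<bar>c\<bar> * v x) \<and> (\<forall>x y. v (x + y) \<le> v x + v y)"

definition extremal_solution ::
    "(real^'n^'n) set \<Rightarrow> (real^'n \<Rightarrow> real) \<Rightarrow> (real \<Rightarrow> real^'n) \<Rightarrow> bool" where
  "extremal_solution M v x \<longleftrightarrow> switched_solution M x \<and> (\<forall>t\<ge>0. v (x t) = v (x 0))"

definition barabanov_norm :: "(real^'n^'n) set \<Rightarrow> (real^'n \<Rightarrow> real) \<Rightarrow> bool" where
  "barabanov_norm M v \<longleftrightarrow> is_norm v \<and>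
     (\<forall>x t. switched_solution M x \<and> 0 \<le> t \<longrightarrow> v (x t) \<le> v (x 0)) \<and>
     (\<forall>y. \<exists>x. switched_solution M x \<and> x 0 = y \<and> (\<forall>t\<ge>0. v (x t) = v y))"

text \<open>The limit directions at \<open>x\<^sub>0\<close>, from the past, of extremal solutions through \<open>x\<^sub>0\<close>.\<close>

definition extremal_left_directions ::
    "(real^'n^'n) set \<Rightarrow> (real^'n \<Rightarrow> real) \<Rightarrow> real^'n \<Rightarrow> (real^'n) set" where
  "extremal_left_directions M v x\<^sub>0 =
     {l. \<exists>t\<^sub>0>0. \<exists>x. \<exists>\<tau>::nat \<Rightarrow> real.
           extremal_solution M v x \<and> x t\<^sub>0 = x\<^sub>0 \<and>
           (\<forall>j. 0 \<le> \<tau> j \<and> \<tau> j < t\<^sub>0) \<and> \<tau> \<longlonglongrightarrow> t\<^sub>0 \<and>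
           (\<lambda>j. (x (\<tau> j) - x\<^sub>0) /\<^sub>R (\<tau> j - t\<^sub>0)) \<longlonglongrightarrow> l}"

end

theory Submission
  imports Defs
begin

text \<open>A subgradient \<open>p\<close> of \<open>v\<close> at \<open>x\<^sub>0\<close> is orthogonal to every left direction \<open>l\<close>. Indeed an
  extremal solution through \<open>x\<^sub>0\<close> stays on the unit sphere, where \<open>p\<close> is at most \<open>p \<bullet> x\<^sub>0\<close>, so its
  left difference quotients satisfy \<open>p \<bullet> l \<ge> 0\<close>. Conversely, for \<open>A\<close> in \<open>M\<close> the curve \<open>exp (t A) x\<^sub>0\<close> is a
  solution, along which \<open>v\<close> does not increase, so \<open>p \<bullet> A x\<^sub>0 \<le> 0\<close>, and the velocities of the extremal
  solution near \<open>x\<^sub>0\<close> are close to such vectors. Together with \<open>p \<bullet> x\<^sub>0 = 1\<close>, orthogonality to \<open>n - 1\<close>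
  independent vectors determines \<open>p\<close>, and a norm with a unique subgradient at a point is
  differentiable there.\<close>

subsection \<open>Absolutely continuous functions\<close>

text \<open>Enumerating a finite index set by an initial segment of the naturals brings it to the
  form in the definition of absolute continuity. The indices to come are the pairs of tag and
  interval of a tagged division.\<close>

lemma absolutely_continuous_on_interval_finite_family:
  assumes "absolutely_continuous_on_interval s t f" and "e > 0"
  shows "\<exists>\<delta>>0. \<forall>(q::'i set) u w. finite q \<longrightarrow>
           (\<forall>k\<in>q. s \<le> u k \<and> u k \<le> w k \<and> w k \<le> t) \<longrightarrow>
           disjoint_family_on (\<lambda>k. {u k<..<w k}) q \<longrightarrow> (\<Sum>k\<in>q. w k - u k) < \<delta> \<longrightarrow>
           (\<Sum>k\<in>q. norm (f (w k) - f (u k))) < e"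
proof -
  obtain \<delta> where "\<delta> > 0" and \<delta>: "\<And>(N::nat) a b. \<lbrakk>\<forall>i<N. s \<le> a i \<and> a i \<le> b i \<and> b i \<le> t;
      disjoint_family_on (\<lambda>i. {a i<..<b i}) {..<N}; (\<Sum>i<N. b i - a i) < \<delta>\<rbrakk>
      \<Longrightarrow> (\<Sum>i<N. norm (f (b i) - f (a i))) < e"
    using assms unfolding absolutely_continuous_on_interval_def by meson
  show ?thesis
  proof (intro exI[of _ \<delta>] conjI allI impI \<open>\<delta> > 0\<close>)
    fix q :: "'i set" and u w
    assume q: "finite q" and uw: "\<forall>k\<in>q. s \<le> u k \<and> u k \<le> w k \<and> w k \<le> t"
      and disj: "disjoint_family_on (\<lambda>k. {u k<..<w k}) q" and len: "(\<Sum>k\<in>q. w k - u k) < \<delta>"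
    obtain h where h: "bij_betw h {..<card q} q"
      using bij_betw_from_nat_into_finite[OF q] by blast
    have hq: "h i \<in> q" if "i < card q" for i
      using h that by (auto simp: bij_betw_def)
    have "(\<Sum>i<card q. norm (f (w (h i)) - f (u (h i)))) < e"
    proof (rule \<delta>)
      show "\<forall>i<card q. s \<le> u (h i) \<and> u (h i) \<le> w (h i) \<and> w (h i) \<le> t"
        using uw hq by blast
      show "disjoint_family_on (\<lambda>i. {u (h i)<..<w (h i)}) {..<card q}"
        unfolding disjoint_family_on_def
      proof (intro ballI impI)
        fix i j assume ij: "i \<in> {..<card q}" "j \<in> {..<card q}" "i \<noteq> j"
        then have "h i \<noteq> h j" using h by (auto simp: bij_betw_def inj_on_def)
        then show "{u (h i)<..<w (h i)} \<inter> {u (h j)<..<w (h j)} = {}"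
          using disj hq ij unfolding disjoint_family_on_def by blast
      qed
      show "(\<Sum>i<card q. w (h i) - u (h i)) < \<delta>"
        using len sum.reindex_bij_betw[OF h, of "\<lambda>k. w k - u k"] by simp
    qed
    then show "(\<Sum>k\<in>q. norm (f (w k) - f (u k))) < e"
      using sum.reindex_bij_betw[OF h, of "\<lambda>k. norm (f (w k) - f (u k))"] by simp
  qed
qed

lemma absolutely_continuous_on_interval_subset:
  assumes "absolutely_continuous_on_interval s t f" "s \<le> s'" "t' \<le> t"
  shows "absolutely_continuous_on_interval s' t' f"
  unfolding absolutely_continuous_on_interval_def
proof (intro allI impI)
  fix e :: real assume "e > 0"
  then obtain \<delta> where "\<delta> > 0" and \<delta>: "\<And>(N::nat) a b. \<lbrakk>\<forall>i<N. s \<le> a i \<and> a i \<le> b i \<and> b i \<le> t;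
      disjoint_family_on (\<lambda>i. {a i<..<b i}) {..<N}; (\<Sum>i<N. b i - a i) < \<delta>\<rbrakk>
      \<Longrightarrow> (\<Sum>i<N. norm (f (b i) - f (a i))) < e"
    using assms(1) unfolding absolutely_continuous_on_interval_def by meson
  have "(\<Sum>i<N. norm (f (b i) - f (a i))) < e"
    if "\<forall>i<N. s' \<le> a i \<and> a i \<le> b i \<and> b i \<le> t'"
      "disjoint_family_on (\<lambda>i. {a i<..<b i}) {..<N}" "(\<Sum>i<N. b i - a i) < \<delta>"
    for N :: nat and a b
    using that assms(2,3) by (intro \<delta>) (auto intro: order_trans)
  with \<open>\<delta> > 0\<close> show "\<exists>\<delta>>0. \<forall>(N::nat) a b.
        (\<forall>i<N. s' \<le> a i \<and> a i \<le> b i \<and> b i \<le> t') \<longrightarrow>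
        disjoint_family_on (\<lambda>i. {a i<..<b i}) {..<N} \<longrightarrow>
        (\<Sum>i<N. b i - a i) < \<delta> \<longrightarrow> (\<Sum>i<N. norm (f (b i) - f (a i))) < e"
    by blast
qed

lemma absolutely_continuous_on_interval_lipschitz_compose:
  assumes "absolutely_continuous_on_interval s t f"
    and L: "\<And>x y. norm (g x - g y) \<le> L * norm (x - y)"
  shows "absolutely_continuous_on_interval s t (\<lambda>x. g (f x))"
  unfolding absolutely_continuous_on_interval_def
proof (intro allI impI)
  fix e :: real assume "e > 0"
  \<comment> \<open>The sign of \<open>L\<close> is left open; \<open>\<bar>L\<bar> + 1\<close> is
    also a Lipschitz constant, and a positive one.\<close>
  then have "e / (\<bar>L\<bar> + 1) > 0" by simp
  then obtain \<delta> where "\<delta> > 0" and \<delta>: "\<And>(N::nat) a b. \<lbrakk>\<forall>i<N. s \<le> a i \<and> a i \<le> b i \<and> b i \<le> t;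
      disjoint_family_on (\<lambda>i. {a i<..<b i}) {..<N}; (\<Sum>i<N. b i - a i) < \<delta>\<rbrakk>
      \<Longrightarrow> (\<Sum>i<N. norm (f (b i) - f (a i))) < e / (\<bar>L\<bar> + 1)"
    using assms(1) unfolding absolutely_continuous_on_interval_def by meson
  have "(\<Sum>i<N. norm (g (f (b i)) - g (f (a i)))) < e"
    if *: "\<forall>i<N. s \<le> a i \<and> a i \<le> b i \<and> b i \<le> t"
      "disjoint_family_on (\<lambda>i. {a i<..<b i}) {..<N}" "(\<Sum>i<N. b i - a i) < \<delta>"
    for N :: nat and a b
  proof -
    have "norm (g x - g y) \<le> (\<bar>L\<bar> + 1) * norm (x - y)" for x y
      using L[of x y] by (smt (verit) mult_right_mono norm_ge_zero)
    then have "(\<Sum>i<N. norm (g (f (b i)) - g (f (a i))))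
        \<le> (\<Sum>i<N. (\<bar>L\<bar> + 1) * norm (f (b i) - f (a i)))"
      by (intro sum_mono)
    also have "\<dots> = (\<bar>L\<bar> + 1) * (\<Sum>i<N. norm (f (b i) - f (a i)))"
      by (simp add: sum_distrib_left)
    also have "\<dots> < (\<bar>L\<bar> + 1) * (e / (\<bar>L\<bar> + 1))"
      using \<delta>[OF *] by (intro mult_strict_left_mono) auto
    finally show ?thesis by simp
  qed
  with \<open>\<delta> > 0\<close> show "\<exists>\<delta>>0. \<forall>(N::nat) a b.
        (\<forall>i<N. s \<le> a i \<and> a i \<le> b i \<and> b i \<le> t) \<longrightarrow>
        disjoint_family_on (\<lambda>i. {a i<..<b i}) {..<N} \<longrightarrow>
        (\<Sum>i<N. b i - a i) < \<delta> \<longrightarrow> (\<Sum>i<N. norm (g (f (b i)) - g (f (a i)))) < e"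
    by blast
qed

lemma absolutely_continuous_on_interval_imp_continuous_on:
  assumes "absolutely_continuous_on_interval s t f"
  shows "continuous_on {s..t} f"
  unfolding continuous_on_iff
proof (intro ballI allI impI)
  fix x e :: real assume x: "x \<in> {s..t}" and "e > 0"
  obtain \<delta> where "\<delta> > 0" and \<delta>: "\<And>(N::nat) a b. \<lbrakk>\<forall>i<N. s \<le> a i \<and> a i \<le> b i \<and> b i \<le> t;
      disjoint_family_on (\<lambda>i. {a i<..<b i}) {..<N}; (\<Sum>i<N. b i - a i) < \<delta>\<rbrakk>
      \<Longrightarrow> (\<Sum>i<N. norm (f (b i) - f (a i))) < e"
    using assms \<open>e > 0\<close> unfolding absolutely_continuous_on_interval_def by meson
  \<comment> \<open>A family of one interval suffices; \<open>min\<close> and \<open>max\<close> put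
    its endpoints in order.\<close>
  have "dist (f y) (f x) < e" if "y \<in> {s..t}" "dist y x < \<delta>" for y
    using \<delta>[of 1 "\<lambda>_. min x y" "\<lambda>_. max x y"] x that
    by (cases "x \<le> y")
      (auto simp: disjoint_family_on_def dist_norm norm_minus_commute min_def max_def)
  with \<open>\<delta> > 0\<close> show "\<exists>\<delta>>0. \<forall>y\<in>{s..t}. dist y x < \<delta> \<longrightarrow> dist (f y) (f x) < e"
    by blast
qed

lemma lipschitz_imp_absolutely_continuous_on_interval:
  assumes L: "\<And>x y. \<lbrakk>x \<in> {s..t}; y \<in> {s..t}\<rbrakk> \<Longrightarrow> norm (f x - f y) \<le> L * \<bar>x - y\<bar>"
  shows "absolutely_continuous_on_interval s t f"
  unfolding absolutely_continuous_on_interval_def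
proof (intro allI impI)
  fix e :: real assume "e > 0"
  have "(\<Sum>i<N. norm (f (b i) - f (a i))) < e"
    if *: "\<forall>i<N. s \<le> a i \<and> a i \<le> b i \<and> b i \<le> t" "(\<Sum>i<N. b i - a i) < e / (\<bar>L\<bar> + 1)"
    for N :: nat and a b
  proof -
    have "norm (f (b i) - f (a i)) \<le> (\<bar>L\<bar> + 1) * (b i - a i)" if "i < N" for i
    proof -
      have "norm (f (b i) - f (a i)) \<le> L * \<bar>b i - a i\<bar>"
        using * that by (intro L) force+
      also have "\<dots> \<le> (\<bar>L\<bar> + 1) * (b i - a i)"
        using * that by (simp add: mult_right_mono)
      finally show ?thesis .
    qed
    then have "(\<Sum>i<N. norm (f (b i) - f (a i))) \<le> (\<Sum>i<N. (\<bar>L\<bar> + 1) * (b i - a i))"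
      by (intro sum_mono) auto
    also have "\<dots> = (\<bar>L\<bar> + 1) * (\<Sum>i<N. b i - a i)"
      by (simp add: sum_distrib_left)
    also have "\<dots> < (\<bar>L\<bar> + 1) * (e / (\<bar>L\<bar> + 1))"
      using * by (intro mult_strict_left_mono) auto
    finally show ?thesis by simp
  qed
  moreover have "e / (\<bar>L\<bar> + 1) > 0" using \<open>e > 0\<close> by simp
  ultimately show "\<exists>\<delta>>0. \<forall>(N::nat) a b.
        (\<forall>i<N. s \<le> a i \<and> a i \<le> b i \<and> b i \<le> t) \<longrightarrow>
        disjoint_family_on (\<lambda>i. {a i<..<b i}) {..<N} \<longrightarrow>
        (\<Sum>i<N. b i - a i) < \<delta> \<longrightarrow> (\<Sum>i<N. norm (f (b i) - f (a i))) < e"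
    by blast
qed

text \<open>In a fine tagged division, the intervals tagged outside \<open>N\<close> are controlled by the derivative,
  and those tagged in \<open>N\<close> lie in an open set of small measure, where absolute continuity applies.\<close>

lemma absolutely_continuous_increment_le:
  fixes g :: "real \<Rightarrow> real"
  assumes "a \<le> b" and "c \<ge> 0" and ac: "absolutely_continuous_on_interval a b g"
    and "negligible N"
    and der: "\<And>t. t \<in> {a..b} - N \<Longrightarrow>
      \<exists>d\<le>c. (g has_vector_derivative d) (at t within {a..b})"
  shows "g b - g a \<le> c * (b - a)"
proof (rule field_le_epsilon)
  fix e :: real assume "e > 0"
  \<comment> \<open>A slack of \<open>e1\<close> in the slope costs at most \<open>e / 2\<close>
    over the whole interval; the other half is left for the tags in \<open>N\<close>. Adding 1 keeps
    the denominator positive when \<open>a = b\<close>.\<close>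
  define e1 where "e1 = e / 2 / (b - a + 1)"
  have "e1 > 0" using \<open>e > 0\<close> \<open>a \<le> b\<close> by (simp add: e1_def)
  obtain \<delta> where "\<delta> > 0" and \<delta>: "\<And>q u w. \<lbrakk>finite (q :: (real \<times> real set) set);
           \<forall>k\<in>q. a \<le> u k \<and> u k \<le> w k \<and> w k \<le> b;
           disjoint_family_on (\<lambda>k. {u k<..<w k}) q; (\<Sum>k\<in>q. w k - u k) < \<delta>\<rbrakk>
         \<Longrightarrow> (\<Sum>k\<in>q. norm (g (w k) - g (u k))) < e / 2"
    using absolutely_continuous_on_interval_finite_family[OF ac half_gt_zero[OF \<open>e > 0\<close>],
        where 'i = "real \<times> real set"] by blast
  have N0: "emeasure lebesgue N = 0" and Nm: "N \<in> sets lebesgue"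
    using \<open>negligible N\<close> by (auto simp: negligible_iff_null_sets null_sets_def)
  \<comment> \<open>Since \<open>N\<close> is null, an open set exceeding it by measure less than
    \<open>\<delta>\<close> itself has measure less than \<open>\<delta>\<close>.\<close>
  obtain U where U: "open U" "N \<subseteq> U" "(U - N) \<in> lmeasurable" "emeasure lebesgue (U - N) < ennreal \<delta>"
    using sets_lebesgue_outer_open[OF Nm \<open>\<delta> > 0\<close>] by blast
  have UNU: "N \<union> (U - N) = U" using U(2) by blast
  have Um: "U \<in> lmeasurable"
    using fmeasurable.Un[OF negligible_imp_measurable[OF \<open>negligible N\<close>] U(3)] UNU by simp
  have eU: "emeasure lebesgue U < ennreal \<delta>"
    using U(3,4) UNU emeasure_Un_null_set[of "U - N" lebesgue N] N0 Nm
    by (simp add: null_sets_def fmeasurable_def Un_commute)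
  have mU: "measure lebesgue U < \<delta>"
    using eU emeasure_eq_measure2[OF Um] \<open>\<delta> > 0\<close> by (simp add: ennreal_less_iff)
  \<comment> \<open>The gauge: around points of \<open>N\<close> the ball stays in \<open>U\<close>;
    at the other points of \<open>{a..b}\<close> differentiability bounds the slope over every short
    interval containing the point. For all remaining \<open>t\<close> any radius works.\<close>
  have "\<exists>r>0. (t \<in> N \<longrightarrow> ball t r \<subseteq> U) \<and> (t \<in> {a..b} - N \<longrightarrow>
      (\<forall>u w. a \<le> u \<and> u \<le> t \<and> t \<le> w \<and> w \<le> b \<and> u \<in> ball t r \<and> w \<in> ball t r \<longrightarrow>
        g w - g u \<le> (c + e1) * (w - u)))" for t
  proof (cases "t \<in> {a..b} - N")
    case True
    then obtain d where "d \<le> c" and d: "(g has_vector_derivative d) (at t within {a..b})"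
      using der by blast
    then obtain r where "r > 0" and r: "\<And>y. y \<in> {a..b} \<Longrightarrow> \<bar>y - t\<bar> < r \<Longrightarrow>
        \<bar>g y - g t - (y - t) * d\<bar> \<le> e1 * \<bar>y - t\<bar>"
      unfolding has_vector_derivative_def has_derivative_within_alt
      using \<open>e1 > 0\<close> by (metis real_norm_def real_scaleR_def)
    \<comment> \<open>As \<open>t\<close> lies between \<open>u\<close> and \<open>w\<close>, the
      error bounds on its two sides add up to exactly \<open>e1 * (w - u)\<close>.\<close>
    have "g w - g u \<le> (c + e1) * (w - u)"
      if "a \<le> u \<and> u \<le> t \<and> t \<le> w \<and> w \<le> b \<and> u \<in> ball t r \<and> w \<in> ball t r" for u w
    proof -
      have "\<bar>g u - g t - (u - t) * d\<bar> \<le> e1 * (t - u)" "\<bar>g w - g t - (w - t) * d\<bar> \<le> e1 * (w - t)"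
        using r[of u] r[of w] that by (auto simp: dist_real_def)
      then have "g w - g u \<le> (w - t) * d - (u - t) * d + e1 * (t - u) + e1 * (w - t)"
        by linarith
      also have "\<dots> = (d + e1) * (w - u)" by (simp add: algebra_simps)
      also have "\<dots> \<le> (c + e1) * (w - u)" using \<open>d \<le> c\<close> that by (intro mult_right_mono) auto
      finally show ?thesis .
    qed
    with True \<open>r > 0\<close> show ?thesis by auto
  next
    case False
    show ?thesis
    proof (cases "t \<in> N")
      case True
      then obtain r where "r > 0" "ball t r \<subseteq> U" using U(1,2) openE by (metis subsetD)
      with True show ?thesis by auto
    qed (use False in \<open>auto intro: exI[of _ 1]\<close>)
  qed
  then obtain r where r0: "\<And>t. r t > 0" and rN: "\<And>t. t \<in> N \<Longrightarrow> ball t (r t) \<subseteq> U"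
    and rD: "\<And>t u w. \<lbrakk>t \<in> {a..b} - N; a \<le> u; u \<le> t; t \<le> w; w \<le> b; u \<in> ball t (r t);
        w \<in> ball t (r t)\<rbrakk> \<Longrightarrow> g w - g u \<le> (c + e1) * (w - u)"
    by metis
  have "gauge (\<lambda>t. ball t (r t))" using r0 by (auto simp: gauge_def)
  then obtain p where p: "p tagged_division_of {a..b}" and fine: "(\<lambda>t. ball t (r t)) fine p"
    using fine_division_exists_real by blast
  have fp: "finite p" using p by blast
  have K: "\<exists>u w. K = {u..w} \<and> u \<le> w \<and> a \<le> u \<and> w \<le> b \<and> x \<in> {u..w} \<and> {u..w} \<subseteq> ball x (r x)"
    if xK: "(x, K) \<in> p" for x K
  proof -
    obtain u w where "K = {u..w}" using tagged_division_ofD(4)[OF p xK] by auto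
    moreover have "x \<in> K" "K \<subseteq> {a..b}" using tagged_division_ofD(2,3)[OF p xK] by auto
    moreover have "K \<subseteq> ball x (r x)" using fine xK by auto
    ultimately show ?thesis by auto
  qed
  define q where "q = {k \<in> p. fst k \<in> N}"
  have fq: "finite q" and qp: "q \<subseteq> p" using fp by (auto simp: q_def)
  \<comment> \<open>Each interval of the division contains its tag, so it is nonempty and
    \<open>Inf\<close> and \<open>Sup\<close> are its endpoints.\<close>
  define lo up :: "real \<times> real set \<Rightarrow> real" where "lo = (\<lambda>k. Inf (snd k))" and "up = (\<lambda>k. Sup (snd k))"
  have luK: "snd k = {lo k..up k} \<and> lo k \<le> up k \<and> a \<le> lo k \<and> up k \<le> b \<and> fst k \<in> {lo k..up k}
     \<and> {lo k..up k} \<subseteq> ball (fst k) (r (fst k))" if "k \<in> p" for k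
    using K[of "fst k" "snd k"] that by (auto simp: lo_def up_def)
  have disj: "disjoint_family_on (\<lambda>k. {lo k<..<up k}) p"
    unfolding disjoint_family_on_def
  proof (intro ballI impI)
    fix k k' assume kk: "k \<in> p" "k' \<in> p" "k \<noteq> k'"
    then have "interior (snd k) \<inter> interior (snd k') = {}"
      using tagged_division_ofD(5)[OF p, of "fst k" "snd k" "fst k'" "snd k'"] by auto
    then show "{lo k<..<up k} \<inter> {lo k'<..<up k'} = {}"
      using luK kk by (metis interior_atLeastAtMost_real)
  qed
  have disjq: "disjoint_family_on (\<lambda>k. {lo k<..<up k}) q"
    using disj qp by (rule disjoint_family_on_mono[rotated])
  \<comment> \<open>The total length is the measure of a disjoint union of open intervals, all
    inside \<open>U\<close> because their tags lie in \<open>N\<close>.\<close>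
  have "(\<Sum>k\<in>q. up k - lo k) = (\<Sum>k\<in>q. measure lebesgue {lo k<..<up k})"
    using luK qp by (intro sum.cong) auto
  also have "\<dots> = measure lebesgue (\<Union>k\<in>q. {lo k<..<up k})"
  proof (rule measure_finite_Union[OF fq _ disjq, symmetric])
    show "emeasure lebesgue {lo k<..<up k} \<noteq> \<infinity>" for k
      using fmeasurableD2[OF lmeasurable_box[of "lo k" "up k"]] by (simp del: emeasure_completion)
  qed auto
  also have "\<dots> \<le> measure lebesgue U"
  proof (rule measure_mono_fmeasurable[OF _ _ Um])
    show "(\<Union>k\<in>q. {lo k<..<up k}) \<subseteq> U"
    proof
      fix y assume "y \<in> (\<Union>k\<in>q. {lo k<..<up k})"
      then obtain k where k: "k \<in> q" "y \<in> {lo k..up k}" by force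
      then show "y \<in> U" using luK[of k] rN[of "fst k"] by (auto simp: q_def)
    qed
    show "(\<Union>k\<in>q. {lo k<..<up k}) \<in> sets lebesgue"
      by (simp add: open_UN borel_open)
  qed
  finally have lenq: "(\<Sum>k\<in>q. up k - lo k) < \<delta>" using mU by simp
  have bad: "(\<Sum>k\<in>q. norm (g (up k) - g (lo k))) < e / 2"
    using luK qp by (intro \<delta> fq disjq lenq) auto
  have good: "(\<Sum>k\<in>p - q. g (up k) - g (lo k)) \<le> (\<Sum>k\<in>p - q. (c + e1) * (up k - lo k))"
  proof (rule sum_mono)
    fix k assume k: "k \<in> p - q"
    then have kp: "k \<in> p" and kN: "fst k \<notin> N" by (auto simp: q_def)
    have "lo k \<in> {lo k..up k}" "up k \<in> {lo k..up k}" using luK[OF kp] by simp_all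
    then have "lo k \<in> ball (fst k) (r (fst k))" "up k \<in> ball (fst k) (r (fst k))"
      using luK[OF kp] by blast+
    then show "g (up k) - g (lo k) \<le> (c + e1) * (up k - lo k)"
      using luK[OF kp] kN by (intro rD[of "fst k"]) auto
  qed
  have tot: "(\<Sum>k\<in>p. up k - lo k) = b - a"
    using additive_tagged_division_1[OF \<open>a \<le> b\<close> p, of "\<lambda>x. x"]
    by (simp add: up_def lo_def case_prod_beta)
  have "g b - g a = (\<Sum>k\<in>p. g (up k) - g (lo k))"
    using additive_tagged_division_1[OF \<open>a \<le> b\<close> p, of g]
    by (simp add: up_def lo_def case_prod_beta)
  also have "\<dots> = (\<Sum>k\<in>p - q. g (up k) - g (lo k)) + (\<Sum>k\<in>q. g (up k) - g (lo k))"
    by (rule sum.subset_diff[OF qp fp])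
  also have "(\<Sum>k\<in>q. g (up k) - g (lo k)) \<le> (\<Sum>k\<in>q. norm (g (up k) - g (lo k)))"
    by (intro sum_mono) simp
  \<comment> \<open>The terms tagged in \<open>N\<close> are put back so that the lengths sum to
    \<open>b - a\<close>; they are nonnegative because \<open>c \<ge> 0\<close>.\<close>
  also have "(\<Sum>k\<in>p - q. g (up k) - g (lo k)) \<le> (\<Sum>k\<in>p. (c + e1) * (up k - lo k))"
  proof (rule order_trans[OF good sum_mono2[OF fp]])
    fix k assume "k \<in> p - (p - q)"
    then show "0 \<le> (c + e1) * (up k - lo k)"
      using luK[of k] \<open>c \<ge> 0\<close> \<open>e1 > 0\<close> by simp
  qed auto
  also have "(\<Sum>k\<in>p. (c + e1) * (up k - lo k)) = (c + e1) * (b - a)"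
    by (simp add: tot flip: sum_distrib_left)
  finally have "g b - g a \<le> (c + e1) * (b - a) + (\<Sum>k\<in>q. norm (g (up k) - g (lo k)))" by simp
  also have "\<dots> \<le> c * (b - a) + e1 * (b - a) + e / 2"
    using bad by (simp add: algebra_simps)
  also have "e1 * (b - a) \<le> e / 2"
    using \<open>e > 0\<close> \<open>a \<le> b\<close> by (simp add: e1_def field_simps)
  finally show "g b - g a \<le> c * (b - a) + e" by simp
qed

subsection \<open>Linear differential equations with constant coefficients\<close>

text \<open>Cauchy-Schwarz bounds each component by the norm of a row, which is at most
  \<open>norm A\<close>; the number of rows enters on summing the components. The constant is crude,
  but any fixed multiple of \<open>norm A\<close> serves.\<close>

lemma matrix_vector_mult_norm_le:
  fixes A :: "real^'n^'m"
  shows "norm (A *v z) \<le> real CARD('m) * norm A * norm z"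
proof -
  have "norm (A *v z) \<le> (\<Sum>i\<in>UNIV. \<bar>(A *v z) $ i\<bar>)"
    by (rule norm_le_l1_cart)
  also have "\<dots> \<le> (\<Sum>i\<in>(UNIV::'m set). norm A * norm z)"
  proof (rule sum_mono)
    fix i
    have "\<bar>(A *v z) $ i\<bar> \<le> norm (A $ i) * norm z"
      by (simp add: matrix_vector_mul_component Cauchy_Schwarz_ineq2)
    also have "\<dots> \<le> norm A * norm z"
      by (intro mult_right_mono Finite_Cartesian_Product.norm_nth_le) auto
    finally show "\<bar>(A *v z) $ i\<bar> \<le> norm A * norm z" .
  qed
  finally show ?thesis by simp
qed

text \<open>The solution is the exponential series of \<open>t A\<close> applied to
  \<open>y\<close>. Each component is a real power series in \<open>t\<close>, so termwise
  differentiation of scalar series is enough.\<close>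

lemma linear_ode_solution_exists:
  fixes A :: "real^'n^'n"
  obtains x where "x 0 = y" and "\<And>t. (x has_vector_derivative (A *v x t)) (at t)"
proof -
  define c where "c = (\<lambda>i n. ((((*v) A) ^^ n) y) $ i / fact n)"
  define x where "x = (\<lambda>t::real. \<chi> i. \<Sum>n. c i n * t ^ n)"
  define K where "K = real CARD('n) * norm A"
  have K: "norm (A *v z) \<le> K * norm z" for z
    unfolding K_def by (rule matrix_vector_mult_norm_le)
  have "K \<ge> 0" by (simp add: K_def)
  have pow: "norm ((((*v) A) ^^ n) y) \<le> K ^ n * norm y" for n
  proof (induction n)
    case (Suc n)
    have "norm ((((*v) A) ^^ Suc n) y) \<le> K * norm ((((*v) A) ^^ n) y)" using K by simp
    also have "\<dots> \<le> K * (K ^ n * norm y)" using Suc \<open>K \<ge> 0\<close> by (rule mult_left_mono)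
    finally show ?case by simp
  qed simp
  have summ: "summable (\<lambda>n. c i n * t ^ n)" for i t
  proof (rule summable_comparison_test')
    show "summable (\<lambda>n. norm y * (inverse (fact n) * (K * \<bar>t\<bar>) ^ n))"
      by (intro summable_mult summable_exp)
    fix n :: nat
    have "\<bar>((((*v) A) ^^ n) y) $ i\<bar> \<le> K ^ n * norm y"
      using component_le_norm_cart pow order_trans by blast
    then have "\<bar>((((*v) A) ^^ n) y) $ i\<bar> * (\<bar>t\<bar> ^ n / fact n) \<le> K ^ n * norm y * (\<bar>t\<bar> ^ n / fact n)"
      by (rule mult_right_mono) simp
    then show "norm (c i n * t ^ n) \<le> norm y * (inverse (fact n) * (K * \<bar>t\<bar>) ^ n)"
      by (simp add: c_def abs_mult power_abs power_mult_distrib field_simps)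
  qed
  \<comment> \<open>Differentiation shifts the coefficients by one place, and the next iterate is
    \<open>A\<close> applied to the current one.\<close>
  have diffs_c: "diffs (c i) n = (\<Sum>j\<in>UNIV. A $ i $ j * c j n)" for i n
  proof -
    have "diffs (c i) n = ((((*v) A) ^^ Suc n) y) $ i / fact n"
      by (simp add: diffs_def c_def)
    also have "\<dots> = (\<Sum>j\<in>UNIV. A $ i $ j * c j n)"
      by (simp add: matrix_vector_mult_def c_def sum_divide_distrib)
    finally show ?thesis .
  qed
  have "((\<lambda>t. x t $ i) has_field_derivative (A *v x t) $ i) (at t)" for i t
  proof -
    have "(\<Sum>n. diffs (c i) n * t ^ n) = (\<Sum>n. \<Sum>j\<in>UNIV. A $ i $ j * (c j n * t ^ n))"
      by (simp add: diffs_c sum_distrib_right mult.assoc)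
    also have "\<dots> = (\<Sum>j\<in>UNIV. \<Sum>n. A $ i $ j * (c j n * t ^ n))"
      by (intro suminf_sum summable_mult summ)
    also have "\<dots> = (A *v x t) $ i"
      using summ by (simp add: suminf_mult matrix_vector_mult_def x_def)
    finally show ?thesis
      using termdiffs_strong_converges_everywhere[OF summ, of i t] by (simp add: x_def)
  qed
  then have "(x has_vector_derivative (A *v x t)) (at t)" for t
    unfolding has_vector_derivative_def has_derivative_componentwise_within[of x]
    by (auto simp: Basis_vec_def inner_axis has_field_derivative_def mult_commute_abs)
  moreover have "x 0 = y" by (simp add: x_def vec_eq_iff) (simp add: c_def)
  ultimately show thesis using that by blast
qed

subsection \<open>Subgradients of norms\<close>

lemma is_norm_convex_on:
  assumes "is_norm v"
  shows "convex_on UNIV v"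
proof (rule convex_onI)
  fix t x y assume t: "0 < (t::real)" "t < 1"
  have "v ((1 - t) *\<^sub>R x + t *\<^sub>R y) \<le> v ((1 - t) *\<^sub>R x) + v (t *\<^sub>R y)"
    using assms unfolding is_norm_def by blast
  also have "\<dots> = (1 - t) * v x + t * v y"
    using assms t unfolding is_norm_def by simp
  finally show "v ((1 - t) *\<^sub>R x + t *\<^sub>R y) \<le> (1 - t) * v x + t * v y" .
qed auto

text \<open>For a norm these two conditions are equivalent to the usual inequality
  \<open>v y + p \<bullet> (z - y) \<le> v z\<close> for all \<open>z\<close>, as
  \<open>z = 0\<close> and \<open>z = 2 y\<close> show. The first puts \<open>p\<close> in the dual
  unit ball, the second makes it attain \<open>v y\<close>.\<close>

definition norm_subgradient :: "('a::real_inner \<Rightarrow> real) \<Rightarrow> 'a \<Rightarrow> 'a \<Rightarrow> bool" where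
  "norm_subgradient v y p \<longleftrightarrow> (\<forall>z. p \<bullet> z \<le> v z) \<and> p \<bullet> y = v y"

text \<open>For \<open>y \<noteq> 0\<close> a hyperplane separates \<open>y\<close> from the convex
  set of points of smaller norm; its normal, rescaled to have inner product \<open>v y\<close> with
  \<open>y\<close>, is the subgradient.\<close>

lemma norm_subgradient_exists:
  fixes y :: "'a::euclidean_space"
  assumes v: "is_norm v"
  obtains p where "norm_subgradient v y p"
proof (cases "y = 0")
  case True
  then have "norm_subgradient v y 0"
    using v by (simp add: norm_subgradient_def is_norm_def)
  then show thesis by (rule that)
next
  case False
  have pos: "0 \<le> v x" and hom: "v (c *\<^sub>R x) = \<bar>c\<bar> * v x" and zero: "v x = 0 \<longleftrightarrow> x = 0" for x c
    using v unfolding is_norm_def by auto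
  have vy: "v y > 0" using pos[of y] zero[of y] False by linarith
  let ?C = "{z. v z < v y}"
  have "convex ?C"
    unfolding convex_alt
  proof (intro ballI allI impI)
    fix z w t assume *: "z \<in> ?C" "w \<in> ?C" "0 \<le> t \<and> t \<le> (1::real)"
    have "v ((1 - t) *\<^sub>R z + t *\<^sub>R w) \<le> (1 - t) * v z + t * v w"
      using convex_onD[OF is_norm_convex_on[OF v], of t z w] * by simp
    also have "\<dots> < v y"
      using convex_bound_lt[of "v z" "v y" "v w" "1 - t" t] * by simp
    finally show "(1 - t) *\<^sub>R z + t *\<^sub>R w \<in> ?C" by simp
  qed
  moreover have "0 \<in> ?C" using vy zero[of 0] by simp
  ultimately obtain a b where ab: "a \<noteq> 0" "\<And>z. v z < v y \<Longrightarrow> a \<bullet> z \<le> b" "b \<le> a \<bullet> y"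
    using separating_hyperplane_sets[of ?C "{y}"] by auto
  \<comment> \<open>The separation in homogeneous form, free of division by
    \<open>a \<bullet> y\<close>, whose sign is not yet known.\<close>
  have sc: "(a \<bullet> z) * v y \<le> (a \<bullet> y) * v z" for z
  proof -
    \<comment> \<open>For such \<open>s\<close> the point \<open>z / s\<close> is in the separated
      set; afterwards \<open>s\<close> decreases to \<open>v z / v y\<close>.\<close>
    have le: "a \<bullet> z \<le> s * (a \<bullet> y)" if s: "v z / v y < s" for s
    proof -
      have "s > 0" using s pos[of z] vy by (smt (verit) divide_nonneg_pos)
      then have "v ((1 / s) *\<^sub>R z) < v y"
        using s vy by (simp add: hom field_simps)
      then have "a \<bullet> ((1 / s) *\<^sub>R z) \<le> a \<bullet> y" using ab order_trans by blast
      then show ?thesis using \<open>s > 0\<close> by (simp add: field_simps)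
    qed
    have "((\<lambda>s. s * (a \<bullet> y)) \<longlongrightarrow> v z / v y * (a \<bullet> y)) (at_right (v z / v y))"
      by (intro tendsto_intros)
    then have "a \<bullet> z \<le> v z / v y * (a \<bullet> y)"
      by (rule tendsto_lowerbound)
        (auto intro: eventually_mono[OF eventually_at_right_less] le)
    then show ?thesis using vy by (simp add: field_simps)
  qed
  have "a \<bullet> a > 0" using ab(1) by simp
  have "v a > 0" using pos[of a] zero[of a] ab(1) by linarith
  \<comment> \<open>The case \<open>z = a\<close> of \<open>sc\<close> has a positive left
    side.\<close>
  have ay: "a \<bullet> y > 0"
  proof -
    have "0 < (a \<bullet> a) * v y" using \<open>a \<bullet> a > 0\<close> vy by simp
    also have "\<dots> \<le> (a \<bullet> y) * v a" by (rule sc)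
    finally show ?thesis using \<open>v a > 0\<close> by (simp add: zero_less_mult_iff)
  qed
  have "norm_subgradient v y ((v y / (a \<bullet> y)) *\<^sub>R a)"
    unfolding norm_subgradient_def using sc ay vy by (auto simp: field_simps)
  then show thesis by (rule that)
qed

text \<open>A convex function on the whole space is continuous, hence bounded on the compact
  Euclidean unit sphere; homogeneity does the rest.\<close>

lemma is_norm_le_multiple_norm:
  fixes v :: "'a::euclidean_space \<Rightarrow> real"
  assumes v: "is_norm v"
  obtains C where "\<And>z. v z \<le> C * norm z"
proof -
  have "continuous_on (sphere 0 1) v"
    using convex_on_continuous[OF open_UNIV is_norm_convex_on[OF v]] continuous_on_subset by blast
  then have "bounded (v ` sphere 0 1)"
    by (intro compact_imp_bounded compact_continuous_image) auto
  then obtain C where C: "\<And>z. norm z = 1 \<Longrightarrow> v z \<le> C"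
    unfolding bounded_iff by (fastforce dest: order_trans[OF abs_ge_self])
  have "v z \<le> C * norm z" for z
  proof (cases "z = 0")
    case True
    then show ?thesis
      using v unfolding is_norm_def by (metis mult_zero_right norm_zero order_refl)
  next
    case False
    then have "v ((1 / norm z) *\<^sub>R z) \<le> C" by (intro C) simp
    moreover have "v ((1 / norm z) *\<^sub>R z) = 1 / norm z * v z"
      using v unfolding is_norm_def by simp
    ultimately show ?thesis using False by (simp add: field_simps)
  qed
  then show thesis by (rule that)
qed

text \<open>Choose a subgradient \<open>P y\<close> at each \<open>y\<close>. The choice is bounded,
  and limits of subgradients at points tending to \<open>x\<close> are subgradients at
  \<open>x\<close>; by uniqueness and compactness \<open>P\<close> is continuous at
  \<open>x\<close>, and \<open>P x\<close> is the gradient.\<close>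

lemma differentiable_at_unique_norm_subgradient:
  fixes v :: "'a::euclidean_space \<Rightarrow> real"
  assumes v: "is_norm v"
    and uniq: "\<And>p q. \<lbrakk>norm_subgradient v x p; norm_subgradient v x q\<rbrakk> \<Longrightarrow> p = q"
  shows "v differentiable (at x)"
proof -
  have "\<forall>y. \<exists>p. norm_subgradient v y p"
    using norm_subgradient_exists[OF v] by blast
  then obtain P where P: "\<And>y. norm_subgradient v y (P y)" by metis
  obtain C where C: "\<And>z. v z \<le> C * norm z" using is_norm_le_multiple_norm[OF v] by blast
  have cont: "isCont v z" for z
    using convex_on_continuous[OF open_UNIV is_norm_convex_on[OF v]]
    by (simp add: continuous_on_eq_continuous_at)
  \<comment> \<open>The subgradient inequality is tested on \<open>P y\<close> itself; if
    \<open>P y = 0\<close>, a basis vector shows \<open>C \<ge> 0\<close>.\<close>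
  have Pb: "norm (P y) \<le> C" for y
  proof (cases "P y = 0")
    case True
    obtain b :: 'a where b: "b \<in> Basis" using nonempty_Basis by blast
    then show ?thesis using True C[of b] v unfolding is_norm_def
      by (metis norm_Basis mult.right_neutral norm_zero order_trans)
  next
    case False
    have "P y \<bullet> P y \<le> C * norm (P y)" using P[of y] C[of "P y"]
      unfolding norm_subgradient_def by (meson order_trans)
    then show ?thesis using False by (simp add: dot_square_norm power2_eq_square)
  qed
  have lim: "(P \<longlongrightarrow> P x) (at x)"
  proof (rule ccontr)
    assume "\<not> (P \<longlongrightarrow> P x) (at x)"
    then obtain e where "e > 0" and e: "\<And>d. d > 0 \<Longrightarrow> \<exists>y. y \<noteq> x \<and> dist y x < d \<and> e \<le> dist (P y) (P x)"
      unfolding Lim_at by (force simp: not_less)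
    have "\<forall>n. \<exists>y. dist y x < inverse (real (Suc n)) \<and> e \<le> dist (P y) (P x)"
      using e by (metis inverse_positive_iff_positive of_nat_0_less_iff zero_less_Suc)
    then obtain X where X: "\<And>n. dist (X n) x < inverse (real (Suc n))" "\<And>n. e \<le> dist (P (X n)) (P x)"
      by metis
    have "X \<longlonglongrightarrow> x"
      by (rule tendstoI, rule eventually_mono[OF LIMSEQ_inverse_real_of_nat[THEN order_tendstoD(2)]])
        (use X(1) in \<open>auto intro: less_trans\<close>)
    have "\<forall>n. P (X n) \<in> cball 0 C" using Pb by simp
    then obtain q s where "strict_mono (s :: nat \<Rightarrow> nat)" and q: "(P \<circ> X \<circ> s) \<longlonglongrightarrow> q"
      using compact_cball[of "0::'a" C] unfolding compact_def by (metis comp_apply)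
    then have Xs: "(X \<circ> s) \<longlonglongrightarrow> x" using \<open>X \<longlonglongrightarrow> x\<close> by (intro LIMSEQ_subseq_LIMSEQ)
    have "q \<bullet> z \<le> v z" for z
    proof (rule LIMSEQ_le_const2)
      show "(\<lambda>n. (P \<circ> X \<circ> s) n \<bullet> z) \<longlonglongrightarrow> q \<bullet> z" by (intro tendsto_intros q)
    qed (use P in \<open>auto simp: norm_subgradient_def\<close>)
    moreover have "q \<bullet> x = v x"
    proof (rule LIMSEQ_unique)
      show "(\<lambda>n. (P \<circ> X \<circ> s) n \<bullet> (X \<circ> s) n) \<longlonglongrightarrow> q \<bullet> x" by (intro tendsto_intros q Xs)
      have "(\<lambda>n. v ((X \<circ> s) n)) \<longlonglongrightarrow> v x" using isCont_tendsto_compose[OF cont Xs] .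
      then show "(\<lambda>n. (P \<circ> X \<circ> s) n \<bullet> (X \<circ> s) n) \<longlonglongrightarrow> v x"
        using P by (simp add: norm_subgradient_def)
    qed
    ultimately have "q = P x" using uniq P by (simp add: norm_subgradient_def)
    then have "(\<lambda>n. dist ((P \<circ> X \<circ> s) n) (P x)) \<longlonglongrightarrow> 0"
      using q tendsto_dist_iff by blast
    then have "e \<le> 0"
      by (rule LIMSEQ_le_const) (use X(2) in auto)
    then show False using \<open>e > 0\<close> by simp
  qed
  have "(v has_derivative (\<lambda>h. P x \<bullet> h)) (at x)"
    unfolding has_derivative_within_alt
  proof (intro conjI allI impI)
    show "bounded_linear ((\<bullet>) (P x))" by (rule bounded_linear_inner_right)
    fix e :: real assume "e > 0"
    then obtain d where "d > 0" and d: "\<And>y. y \<noteq> x \<Longrightarrow> dist y x < d \<Longrightarrow> dist (P y) (P x) < e"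
      using lim unfolding Lim_at by (metis zero_less_dist_iff)
    have "norm (v y - v x - P x \<bullet> (y - x)) \<le> e * norm (y - x)" if "norm (y - x) < d" for y
    proof (cases "y = x")
      case False
      have Pe: "norm (P y - P x) \<le> e" using d[OF False] that by (simp add: dist_norm)
      \<comment> \<open>The subgradient inequalities at \<open>x\<close> and at \<open>y\<close>
        squeeze the remainder between 0 and \<open>(P y - P x) \<bullet> (y - x)\<close>.\<close>
      have "P x \<bullet> y \<le> v y" "P x \<bullet> x = v x" "P y \<bullet> x \<le> v x" "P y \<bullet> y = v y"
        using P unfolding norm_subgradient_def by auto
      then have "0 \<le> v y - v x - P x \<bullet> (y - x)" "v y - v x - P x \<bullet> (y - x) \<le> (P y - P x) \<bullet> (y - x)"
        by (simp_all add: inner_diff)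
      moreover have "(P y - P x) \<bullet> (y - x) \<le> e * norm (y - x)"
        using norm_cauchy_schwarz Pe by (meson mult_right_mono norm_ge_zero order_trans)
      ultimately show ?thesis by simp
    qed simp
    then show "\<exists>d>0. \<forall>y\<in>UNIV. norm (y - x) < d \<longrightarrow>
        norm (v y - v x - P x \<bullet> (y - x)) \<le> e * norm (y - x)"
      using \<open>d > 0\<close> by blast
  qed
  then show ?thesis by (auto simp: differentiable_def)
qed

subsection \<open>Solutions of the switched system\<close>

text \<open>The velocity of the exponential curve is continuous, so bounded on each
  \<open>{0..T}\<close>; the curve is therefore Lipschitz there, which gives absolute
  continuity.\<close>

lemma switched_solution_constant_law:
  assumes "A \<in> M"
  obtains x where "switched_solution M x" and "x 0 = y"
    and "\<And>t. (x has_vector_derivative (A *v x t)) (at t)"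
proof -
  obtain x where x0: "x 0 = y" and x: "\<And>t. (x has_vector_derivative (A *v x t)) (at t)"
    using linear_ode_solution_exists by blast
  have cont: "continuous_on S x" for S
    using x by (meson continuous_at_imp_continuous_on has_vector_derivative_continuous)
  have "absolutely_continuous_on_interval 0 T x" for T
  proof -
    have "compact ((\<lambda>t. A *v x t) ` {0..T})"
      by (intro compact_continuous_image continuous_on_compose2[OF matrix_vector_mult_linear_continuous_on]
          cont) auto
    then obtain L where L: "\<And>t. t \<in> {0..T} \<Longrightarrow> norm (A *v x t) \<le> L"
      by (meson bounded_iff compact_imp_bounded imageI)
    show ?thesis
    proof (rule lipschitz_imp_absolutely_continuous_on_interval)
      fix s t assume "s \<in> {0..T}" "t \<in> {0..T}"
      moreover have "(x has_derivative (\<lambda>h. h *\<^sub>R (A *v x t))) (at t within {0..T})" for t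
        using x[of t] has_derivative_at_withinI unfolding has_vector_derivative_def by blast
      moreover have "onorm (\<lambda>h. h *\<^sub>R (A *v x t)) \<le> L" if "t \<in> {0..T}" for t
        using L[OF that] by (simp add: onorm_scaleR_left onorm_id)
      ultimately show "norm (x s - x t) \<le> L * \<bar>s - t\<bar>"
        using differentiable_bound[of "{0..T}" x "\<lambda>t h. h *\<^sub>R (A *v x t)" L s t] by simp
    qed
  qed
  moreover have "switching_law M (\<lambda>_. A)" using assms by (simp add: switching_law_def)
  moreover have "AE t in lebesgue_on {0..}. (x has_vector_derivative A *v x t) (at t within {0..})"
    using x has_vector_derivative_at_within by blast
  ultimately have "switched_solution M x" unfolding switched_solution_def by blast
  then show thesis using that x0 x by blast
qed

text \<open>Otherwise \<open>p \<bullet> x t\<close> would exceed its initial value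
  \<open>v y\<close> just after time 0 along the solution with constant law \<open>A\<close>,
  although it is bounded by \<open>v (x t)\<close>, which is at most \<open>v y\<close>.\<close>

lemma norm_subgradient_generator_nonpos:
  assumes v: "barabanov_norm M v" and p: "norm_subgradient v y p" and "A \<in> M"
  shows "p \<bullet> (A *v y) \<le> 0"
proof (rule ccontr)
  assume neg: "\<not> p \<bullet> (A *v y) \<le> 0"
  obtain x where x: "switched_solution M x" "x 0 = y"
    "\<And>t. (x has_vector_derivative (A *v x t)) (at t)"
    using switched_solution_constant_law[OF \<open>A \<in> M\<close>] by blast
  have "((\<lambda>t. p \<bullet> x t) has_real_derivative p \<bullet> (A *v y)) (at 0)"
    using bounded_linear.has_vector_derivative[OF bounded_linear_inner_right x(3)[of 0], of p] x(2)
    by (simp add: has_real_derivative_iff_has_vector_derivative)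
  then obtain d where "d > 0" "\<And>h. \<lbrakk>0 < h; h < d\<rbrakk> \<Longrightarrow> p \<bullet> x 0 < p \<bullet> x (0 + h)"
    using neg DERIV_pos_inc_right[of "\<lambda>t. p \<bullet> x t"] by (meson not_le)
  then have "p \<bullet> x 0 < p \<bullet> x (d / 2)" using \<open>d > 0\<close>
    by (metis add_0 field_sum_of_halves half_gt_zero less_add_same_cancel1)
  also have "\<dots> \<le> v (x (d / 2))" using p by (simp add: norm_subgradient_def)
  also have "\<dots> \<le> v (x 0)" using v x(1) \<open>d > 0\<close> unfolding barabanov_norm_def by simp
  also have "\<dots> = p \<bullet> x 0" using p x(2) by (simp add: norm_subgradient_def)
  finally show False by simp
qed

text \<open>The lower bound holds for every single difference quotient. For the upper bound
  \<open>A t *v x t\<close> is split at \<open>x\<^sub>0\<close>: the part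
  \<open>A t *v x\<^sub>0\<close> pairs nonpositively with \<open>p\<close>, and the rest is small
  uniformly in the law because \<open>M\<close> is bounded.\<close>

lemma norm_subgradient_orthogonal_left_direction:
  fixes M :: "(real^'n^'n) set"
  assumes "compact M" and v: "barabanov_norm M v" and p: "norm_subgradient v x\<^sub>0 p"
    and l: "l \<in> extremal_left_directions M v x\<^sub>0"
  shows "p \<bullet> l = 0"
proof -
  obtain t\<^sub>0 x and \<tau> :: "nat \<Rightarrow> real" where "t\<^sub>0 > 0" and ext: "extremal_solution M v x" and xt0: "x t\<^sub>0 = x\<^sub>0"
    and \<tau>: "\<And>j. 0 \<le> \<tau> j \<and> \<tau> j < t\<^sub>0" and lim\<tau>: "\<tau> \<longlonglongrightarrow> t\<^sub>0"
    and lim: "(\<lambda>j. (x (\<tau> j) - x\<^sub>0) /\<^sub>R (\<tau> j - t\<^sub>0)) \<longlonglongrightarrow> l"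
    using l unfolding extremal_left_directions_def by blast
  have sol: "switched_solution M x" and v0: "\<And>t. t \<ge> 0 \<Longrightarrow> v (x t) = v (x 0)"
    using ext unfolding extremal_solution_def by blast+
  have vx: "v (x t) = v x\<^sub>0" if "t \<ge> 0" for t
    using v0[OF that] v0[of t\<^sub>0] xt0 \<open>t\<^sub>0 > 0\<close> by simp
  have ac: "absolutely_continuous_on_interval 0 t\<^sub>0 x"
    using sol \<open>t\<^sub>0 > 0\<close> unfolding switched_solution_def by simp
  obtain A where A: "\<And>t. t \<ge> 0 \<Longrightarrow> A t \<in> M"
    and "AE t in lebesgue_on {0..}. (x has_vector_derivative (A t *v x t)) (at t within {0..})"
    using sol unfolding switched_solution_def switching_law_def by blast
  \<comment> \<open>Passing from the restricted measure to the whole line yields an exceptional null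
    set \<open>N\<close> of reals.\<close>
  then have "AE t in lebesgue. t \<in> {0..} \<longrightarrow> (x has_vector_derivative (A t *v x t)) (at t within {0..})"
    by (subst (asm) AE_restrict_space_iff) auto
  then obtain N where N: "N \<in> null_sets lebesgue"
    and der: "\<And>t. t \<notin> N \<Longrightarrow> t \<ge> 0 \<Longrightarrow> (x has_vector_derivative (A t *v x t)) (at t within {0..})"
    unfolding eventually_ae_filter by auto
  have "negligible N" using N by (simp add: negligible_iff_null_sets)
  obtain B where B: "\<And>A. A \<in> M \<Longrightarrow> norm A \<le> B"
    using compact_imp_bounded[OF \<open>compact M\<close>] unfolding bounded_iff by blast
  \<comment> \<open>\<open>K\<close> is a Lipschitz constant of
    \<open>z \<mapsto> p \<bullet> (A *v z)\<close> common to all \<open>A\<close> in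
    \<open>M\<close>.\<close>
  define K where "K = real CARD('n) * B * norm p"
  have "B \<ge> 0" using B[OF A[of 0]] by (meson norm_ge_zero order_refl order_trans)
  then have "K \<ge> 0" by (simp add: K_def)
  have vel: "p \<bullet> (A t *v x t) \<le> K * norm (x t - x\<^sub>0)" if "t \<ge> 0" for t
  proof -
    have "p \<bullet> (A t *v x t) = p \<bullet> (A t *v x\<^sub>0) + p \<bullet> (A t *v (x t - x\<^sub>0))"
      by (simp add: matrix_vector_mult_diff_distrib inner_diff_right)
    also have "\<dots> \<le> p \<bullet> (A t *v (x t - x\<^sub>0))"
      using norm_subgradient_generator_nonpos[OF v p A[OF that]] by simp
    also have "\<dots> \<le> norm p * norm (A t *v (x t - x\<^sub>0))" by (rule norm_cauchy_schwarz)
    also have "\<dots> \<le> norm p * (real CARD('n) * norm (A t) * norm (x t - x\<^sub>0))"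
      by (intro mult_left_mono matrix_vector_mult_norm_le) auto
    also have "\<dots> \<le> norm p * (real CARD('n) * B * norm (x t - x\<^sub>0))"
      using B[OF A[OF that]] by (intro mult_left_mono mult_right_mono) auto
    finally show ?thesis by (simp add: K_def mult_ac)
  qed
  have acp: "absolutely_continuous_on_interval 0 t\<^sub>0 (\<lambda>t. p \<bullet> x t)"
    by (rule absolutely_continuous_on_interval_lipschitz_compose[OF ac, of _ "norm p"])
      (simp add: Cauchy_Schwarz_ineq2 flip: inner_diff_right)
  have "p \<bullet> l \<le> e" if "e > 0" for e
  proof (rule LIMSEQ_le_const2[OF tendsto_inner[OF tendsto_const lim]])
    have "e / (K + 1) > 0" using \<open>e > 0\<close> \<open>K \<ge> 0\<close> by simp
    then obtain d where "d > 0" and d: "\<And>t. \<lbrakk>0 \<le> t; t \<le> t\<^sub>0; t\<^sub>0 - t < d\<rbrakk> \<Longrightarrow> norm (x t - x\<^sub>0) < e / (K + 1)"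
      using absolutely_continuous_on_interval_imp_continuous_on[OF ac] \<open>t\<^sub>0 > 0\<close> xt0
      unfolding continuous_on_iff dist_norm by (fastforce dest: bspec[of _ _ t\<^sub>0])
    \<comment> \<open>Within \<open>d\<close> of \<open>t\<^sub>0\<close> the derivative of
      \<open>p \<bullet> x t\<close> is at most \<open>e\<close> off \<open>N\<close>; absolute
      continuity turns this into a bound on the increment.\<close>
    have slope: "p \<bullet> x t\<^sub>0 - p \<bullet> x s \<le> e * (t\<^sub>0 - s)" if s: "0 \<le> s" "s \<le> t\<^sub>0" "t\<^sub>0 - s < d" for s
    proof (rule absolutely_continuous_increment_le[where g = "\<lambda>t. p \<bullet> x t"])
      show "s \<le> t\<^sub>0" by fact
      show "e \<ge> 0" using \<open>e > 0\<close> by simp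
      show "absolutely_continuous_on_interval s t\<^sub>0 (\<lambda>t. p \<bullet> x t)"
        using absolutely_continuous_on_interval_subset[OF acp] s by simp
      show "negligible N" by fact
      fix t assume t: "t \<in> {s..t\<^sub>0} - N"
      have "(x has_vector_derivative (A t *v x t)) (at t within {s..t\<^sub>0})"
        using t s by (intro has_vector_derivative_within_subset[OF der]) auto
      then have "((\<lambda>t. p \<bullet> x t) has_vector_derivative p \<bullet> (A t *v x t)) (at t within {s..t\<^sub>0})"
        by (rule bounded_linear.has_vector_derivative[OF bounded_linear_inner_right])
      moreover have "p \<bullet> (A t *v x t) \<le> e"
      proof -
        have "p \<bullet> (A t *v x t) \<le> K * norm (x t - x\<^sub>0)" using vel t s by simp
        also have "\<dots> \<le> K * (e / (K + 1))"
          using d[of t] t s \<open>K \<ge> 0\<close> by (intro mult_left_mono) auto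
        also have "\<dots> \<le> e" using \<open>e > 0\<close> \<open>K \<ge> 0\<close> by (simp add: field_simps)
        finally show ?thesis .
      qed
      ultimately show "\<exists>d\<le>e. ((\<lambda>t. p \<bullet> x t) has_vector_derivative d) (at t within {s..t\<^sub>0})"
        by blast
    qed
    have "eventually (\<lambda>j. t\<^sub>0 - d < \<tau> j) sequentially"
      using order_tendstoD(1)[OF lim\<tau>, of "t\<^sub>0 - d"] \<open>d > 0\<close> by simp
    then obtain j\<^sub>0 where j0: "\<And>j. j \<ge> j\<^sub>0 \<Longrightarrow> t\<^sub>0 - d < \<tau> j"
      unfolding eventually_sequentially by blast
    show "\<exists>N. \<forall>j\<ge>N. p \<bullet> ((x (\<tau> j) - x\<^sub>0) /\<^sub>R (\<tau> j - t\<^sub>0)) \<le> e"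
    proof (intro exI allI impI)
      fix j assume "j \<ge> j\<^sub>0"
      then have "p \<bullet> x\<^sub>0 - p \<bullet> x (\<tau> j) \<le> e * (t\<^sub>0 - \<tau> j)"
        using slope[of "\<tau> j"] \<tau>[of j] j0[of j] xt0 by auto
      moreover have "\<tau> j - t\<^sub>0 < 0" using \<tau>[of j] by simp
      ultimately have "(p \<bullet> x (\<tau> j) - p \<bullet> x\<^sub>0) / (\<tau> j - t\<^sub>0) \<le> e"
        by (simp add: neg_divide_le_eq algebra_simps)
      then show "p \<bullet> ((x (\<tau> j) - x\<^sub>0) /\<^sub>R (\<tau> j - t\<^sub>0)) \<le> e"
        by (simp add: inner_diff_right divide_inverse_commute)
    qed
  qed
  then have "p \<bullet> l \<le> 0" by (rule field_le_epsilon[of _ 0, simplified])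
  moreover have "p \<bullet> l \<ge> 0"
  proof (rule LIMSEQ_le_const[OF tendsto_inner[OF tendsto_const lim]], intro exI allI impI)
    fix j
    have "p \<bullet> x (\<tau> j) \<le> v (x (\<tau> j))" using p by (simp add: norm_subgradient_def)
    also have "\<dots> = p \<bullet> x\<^sub>0" using p vx[of "\<tau> j"] \<tau>[of j] by (simp add: norm_subgradient_def)
    finally have "p \<bullet> (x (\<tau> j) - x\<^sub>0) \<le> 0" by (simp add: inner_diff_right)
    then show "0 \<le> p \<bullet> ((x (\<tau> j) - x\<^sub>0) /\<^sub>R (\<tau> j - t\<^sub>0))"
      using \<tau>[of j] by (simp add: mult_nonpos_nonpos)
  qed
  ultimately show ?thesis by simp
qed

section \<open>Uniqueness of the subgradient at \<open>x\<^sub>0\<close>\<close>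

theorem proposition3:
  fixes M :: "(real^'n^'n) set" and v :: "real^'n \<Rightarrow> real" and x\<^sub>0 :: "real^'n"
  assumes "compact M" and "convex M" and "irreducible_matrices M"
    and "max_lyapunov_exponent M = 0"
    and "barabanov_norm M v"
    and "x\<^sub>0 \<in> {x. v x = 1}"
    and "extremal_left_directions M v x\<^sub>0 \<noteq> {}"
    and "\<exists>B\<subseteq>extremal_left_directions M v x\<^sub>0. independent B \<and> card B = CARD('n) - 1"
  shows "v differentiable (at x\<^sub>0)"
proof (rule differentiable_at_unique_norm_subgradient)
  show "is_norm v" using assms(5) by (simp add: barabanov_norm_def)
  fix p q assume p: "norm_subgradient v x\<^sub>0 p" and q: "norm_subgradient v x\<^sub>0 q"
  obtain B where B: "B \<subseteq> extremal_left_directions M v x\<^sub>0" "independent B" "card B = CARD('n) - 1"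
    using assms(8) by blast
  have x0: "p \<bullet> x\<^sub>0 = 1" "q \<bullet> x\<^sub>0 = 1"
    using p q assms(6) by (auto simp: norm_subgradient_def)
  have orth: "p \<bullet> b = 0" "q \<bullet> b = 0" if "b \<in> B" for b
    using norm_subgradient_orthogonal_left_direction[OF assms(1,5)] p q B(1) that by blast+
  \<comment> \<open>\<open>p\<close> vanishes on \<open>span B\<close> but takes the value 1 at
    \<open>x\<^sub>0\<close>, so adding \<open>x\<^sub>0\<close> to \<open>B\<close> gives a
    basis.\<close>
  have "x\<^sub>0 \<notin> span B"
  proof
    assume "x\<^sub>0 \<in> span B"
    then have "orthogonal p x\<^sub>0" by (rule orthogonal_to_span) (simp add: orth orthogonal_def)
    then show False using x0(1) by (simp add: orthogonal_def)
  qed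
  then have "independent (insert x\<^sub>0 B)" and "x\<^sub>0 \<notin> B"
    using B(2) by (auto simp: independent_insert span_base)
  moreover have "card (insert x\<^sub>0 B) = CARD('n)"
    using \<open>x\<^sub>0 \<notin> B\<close> independent_imp_finite[OF B(2)] B(3) by simp
  ultimately have "span (insert x\<^sub>0 B) = UNIV"
    using card_eq_dim[of "insert x\<^sub>0 B" UNIV] independent_imp_finite[OF B(2)] by auto
  then have "p - q \<in> span (insert x\<^sub>0 B)" by simp
  \<comment> \<open>On the basis \<open>p\<close> and \<open>q\<close> have the same inner products,
    so \<open>p - q\<close> is orthogonal to the whole space, itself included.\<close>
  then have "orthogonal (p - q) (p - q)"
    by (rule orthogonal_to_span) (use x0 orth in \<open>auto simp: orthogonal_def inner_diff_left\<close>)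
  then show "p = q" by (simp add: orthogonal_def)
qed

end
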